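(* To every integer $\ell\geq1$ there exists a compact total relation $f_\ell:[-1,1]\rightrightarrows[-1,2]$ (i.e. a compact subset $f_\ell\subseteq[-1,1]\times[-1,2]$ with $f_\ell(x)\neq\emptyset$ for every $x\in[-1,1]$) which is $\ell$-fold Henkin-continuous but not $(\ell+1)$-fold Henkin-continuous.
   Context: A multifunction (relation) $f:X\rightrightarrows Y$ is a set $f\subseteq X\times Y$ with $f(x)=\{y:(x,y)\in f\}$; total means $f(x)\neq\emptyset$ for all $x\in X$. $B(\cdot,\cdot)$ denotes open balls in metric spaces. $\ell$-fold Henkin-continuity of a total $f:X\rightrightarrows Y$ between metric spaces means $$\begin{pmatrix}\forall\varepsilon_1>0&\exists\delta_1>0\\ \forall x_1\in X&\exists y_1\in f(x_1)\end{pmatrix}\begin{pmatrix}\forall\varepsilon_2>0&\exists\delta_2>0\\ \forall x_2\in B(x_1,\delta_1)&\exists y_2\in f(x_2)\cap B(y_1,\varepsilon_1)\end{pmatrix}\cdots\begin{pmatrix}\forall\varepsilon_\ell>0&\exists\delta_\ell>0\\ \forall x_\ell\in B(x_{\ell-1},\delta_{\ell-1})&\exists y_\ell\in f(x_\ell)\cap B(y_{\ell-1},\varepsilon_{\ell-1})\end{pmatrix}$$ $$\forall x_{\ell+1}\in B(x_\ell,\delta_\ell)\ \exists y_{\ell+1}\in B(y_\ell,\varepsilon_\ell)\cap f(x_{\ell+1}).$$ Each block is a Henkin quantifier: within the $k$-th block, $\delta_k$ may depend on $\varepsilon_k$ but not on $x_k$, and $y_k$ may depend on $x_k$ but not on $\varepsilon_k$;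 both may depend on the variables of the earlier blocks. In Skolemized form: there are functions $\delta_k=\delta_k(\varepsilon_1,\dots,\varepsilon_k,x_1,\dots,x_{k-1})>0$ and $y_k=y_k(\varepsilon_1,\dots,\varepsilon_{k-1},x_1,\dots,x_k)$, $1\le k\le\ell$, such that for all $\varepsilon_1,\dots,\varepsilon_\ell>0$ and all $x_1,\dots,x_{\ell+1}\in X$ with $x_{k+1}\in B(x_k,\delta_k)$ for $1\le k\le \ell$, one has $y_1\in f(x_1)$, $y_{k+1}\in f(x_{k+1})\cap B(y_k,\varepsilon_k)$ for $1\le k<\ell$ (these membership conditions being required whenever the constraints on $x_1,\dots,x_{k+1}$ hold), and there exists $y_{\ell+1}\in f(x_{\ell+1})\cap B(y_\ell,\varepsilon_\ell)$. *)

theory Defs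
  imports "HOL-Analysis.Analysis"
begin

definition total_relation :: "'a set \<Rightarrow> 'b set \<Rightarrow> ('a \<times> 'b) set \<Rightarrow> bool" where
  "total_relation X Y f \<longleftrightarrow> f \<subseteq> X \<times> Y \<and> (\<forall>x\<in>X. f `` {x} \<noteq> {})"

(* Skolemized form of the Henkin quantifier prefix. All indices start at 1. The Skolem functions
   receive as lists exactly those variables they may depend on:
   delta_k sees (eps_1, ..., eps_k) and (x_1, ..., x_(k-1)),
   y_k sees (eps_1, ..., eps_(k-1)) and (x_1, ..., x_k).
   X is the domain as a metric subspace, so its open balls are those of the ambient type,
   intersected with X. Intended for l >= 1 and relations that are total on X. *)
definition Henkin_continuous ::
    "nat \<Rightarrow> 'a::metric_space set \<Rightarrow> ('a \<times> 'b::metric_space) set \<Rightarrow> bool" where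
  "Henkin_continuous l X f \<longleftrightarrow>
     (\<exists>(\<delta> :: nat \<Rightarrow> real list \<Rightarrow> 'a list \<Rightarrow> real) (y :: nat \<Rightarrow> real list \<Rightarrow> 'a list \<Rightarrow> 'b).
      \<forall>(\<epsilon> :: nat \<Rightarrow> real) (x :: nat \<Rightarrow> 'a).
        (\<forall>k\<in>{1..l}. \<epsilon> k > 0) \<and> (\<forall>k\<in>{1..l+1}. x k \<in> X) \<longrightarrow>
        (let d = (\<lambda>k. \<delta> k (map \<epsilon> [1..<k+1]) (map x [1..<k]));
             v = (\<lambda>k. y k (map \<epsilon> [1..<k]) (map x [1..<k+1]))
         in (\<forall>k\<in>{1..l}. d k > 0) \<and>
            (\<forall>k\<in>{1..l}. (\<forall>i\<in>{1..<k}. x (i+1) \<in> ball (x i) (d i)) \<longrightarrow>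
               v k \<in> f `` {x k} \<and> (k > 1 \<longrightarrow> v k \<in> ball (v (k-1)) (\<epsilon> (k-1)))) \<and>
            ((\<forall>i\<in>{1..l}. x (i+1) \<in> ball (x i) (d i)) \<longrightarrow>
               (\<exists>z. z \<in> f `` {x (l+1)} \<inter> ball (v l) (\<epsilon> l)))))"

end

theory Submission
  imports Defs
begin

text \<open>
  Read the Henkin prefix as a game. A point \<open>(x, y)\<close> persists in a relation \<open>h\<close> if points near \<open>x\<close>
  have values under \<open>h\<close> near \<open>y\<close>. If \<open>f\<close> is \<open>l\<close>-fold Henkin-continuous, then the last answer \<open>y\<^sub>l\<close>
  persists in \<open>f\<close>, the answer \<open>y\<^bsub>l-1\<^esub>\<close> persists in the set of points persisting in \<open>f\<close>, and so on
  (\<open>Henkin_continuous_imp_persistent\<close>). So the \<open>l\<close>-fold iterate of \<open>persistent X\<close> on \<open>f\<close> is total.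
  Conversely, in a chain of compact relations \<open>F 0 \<subseteq> F 1 \<subseteq> \<dots> \<subseteq> F l\<close>, where every point of one persists
  in the next, compactness makes the moduli uniform over all points, and answering the \<open>k\<close>-th move
  inside \<open>F (k - 1)\<close> wins (\<open>Henkin_continuous_chain\<close>).

  The counterexamples form one such chain. At its bottom is the step with both values at \<open>0\<close>: its
  points over \<open>0\<close> do not persist in it. To let the value \<open>0\<close> at \<open>x = 0\<close> persist, some values near
  \<open>0\<close> must be added on the right of \<open>0\<close>, and likewise values near \<open>1\<close> on the left. What is added is
  a copy of the previous relation, read at \<open>sin (1 / x)\<close> and scaled by \<open>x\<close>. The scaling makes the
  added part shrink to the missing value, so the result is compact and the step persists. The
  oscillation makes the bad point \<open>0\<close> of the previous relation recur at points \<open>1 / (2 \<pi> n)\<close>,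
  arbitrarily close to \<open>0\<close> on both sides. Hence each stage survives exactly one more iteration of
  \<open>persistent\<close> over \<open>0\<close> than the one before (\<open>persistent_transport\<close>, \<open>zero_not_persistent\<close>).
\<close>

section \<open>Henkin continuity and persistent points\<close>

text \<open>The point \<open>(x, y)\<close> is only forced to be a limit of points of \<open>h\<close>, because in the game it is the
  next answer, chosen after \<open>\<epsilon>\<close>, that is known to lie in \<open>h\<close>.\<close>

definition persistent :: "'a::metric_space set \<Rightarrow> ('a \<times> 'b::metric_space) set \<Rightarrow> ('a \<times> 'b) set" where
  "persistent X h = {(x, y). \<forall>e>0. \<forall>\<^sub>F x' in nhds x. x' \<in> X \<longrightarrow> (\<exists>y'. (x', y') \<in> h \<and> dist y y' < e)}"

lemma persistentI:
  assumes "\<And>e. e > 0 \<Longrightarrow> \<forall>\<^sub>F x' in nhds x. x' \<in> X \<longrightarrow> (\<exists>y'. (x', y') \<in> h \<and> dist y y' < e)"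
  shows "(x, y) \<in> persistent X h"
  using assms by (auto simp: persistent_def)

lemma persistentD:
  assumes "(x, y) \<in> persistent X h" "e > 0"
  shows "\<forall>\<^sub>F x' in nhds x. x' \<in> X \<longrightarrow> (\<exists>y'. (x', y') \<in> h \<and> dist y y' < e)"
  using assms by (auto simp: persistent_def)

text \<open>Backward induction along the game: the reply \<open>v \<epsilon> x k\<close> is fixed before \<open>\<epsilon> k\<close> and \<open>x (k + 1)\<close>
  are chosen, so the next reply witnesses its persistence.\<close>

lemma Henkin_continuous_imp_persistent:
  assumes "Henkin_continuous l X f" "l \<ge> 1" "x0 \<in> X"
  shows "\<exists>y. (x0, y) \<in> (persistent X ^^ l) f"
proof -
  obtain D Y where H: "\<And>\<epsilon> x. (\<forall>k\<in>{1..l}. \<epsilon> k > 0) \<and> (\<forall>k\<in>{1..l+1}. x k \<in> X) \<Longrightarrow>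
        (let d = (\<lambda>k. D k (map \<epsilon> [1..<k+1]) (map x [1..<k]));
             v = (\<lambda>k. Y k (map \<epsilon> [1..<k]) (map x [1..<k+1]))
         in (\<forall>k\<in>{1..l}. d k > 0) \<and>
            (\<forall>k\<in>{1..l}. (\<forall>i\<in>{1..<k}. x (i+1) \<in> ball (x i) (d i)) \<longrightarrow>
               v k \<in> f `` {x k} \<and> (k > 1 \<longrightarrow> v k \<in> ball (v (k-1)) (\<epsilon> (k-1)))) \<and>
            ((\<forall>i\<in>{1..l}. x (i+1) \<in> ball (x i) (d i)) \<longrightarrow>
               (\<exists>z. z \<in> f `` {x (l+1)} \<inter> ball (v l) (\<epsilon> l))))"
    using assms(1) unfolding Henkin_continuous_def by metis
  define d where "d \<epsilon> x k = D k (map \<epsilon> [1..<k+1]) (map x [1..<k])" for \<epsilon> x k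
  define v where "v \<epsilon> x k = Y k (map \<epsilon> [1..<k]) (map x [1..<k+1])" for \<epsilon> x k
  define legal where "legal \<epsilon> x k \<longleftrightarrow> (\<forall>i\<in>{1..l}. \<epsilon> i > 0) \<and> (\<forall>i\<in>{1..l+1}. x i \<in> X) \<and>
      (\<forall>i\<in>{1..<k}. x (i+1) \<in> ball (x i) (d \<epsilon> x i))" for \<epsilon> x k
  have pos: "d \<epsilon> x k > 0" if "legal \<epsilon> x k" "k \<in> {1..l}" for \<epsilon> x k
    using H[of \<epsilon> x] that by (auto simp: Let_def d_def legal_def)
  have near: "v \<epsilon> x (Suc k) \<in> ball (v \<epsilon> x k) (\<epsilon> k)"
    if "legal \<epsilon> x (Suc k)" "1 \<le> k" "k < l" for \<epsilon> x k
  proof -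
    have "\<forall>k\<in>{1..l}. (\<forall>i\<in>{1..<k}. x (i+1) \<in> ball (x i) (d \<epsilon> x i)) \<longrightarrow>
               k > 1 \<longrightarrow> v \<epsilon> x k \<in> ball (v \<epsilon> x (k-1)) (\<epsilon> (k-1))"
      using H[of \<epsilon> x] that(1) unfolding Let_def d_def v_def legal_def by blast
    from this[rule_format, of "Suc k"] that show ?thesis by (auto simp: legal_def)
  qed
  have final: "\<exists>z. (x (l+1), z) \<in> f \<and> dist (v \<epsilon> x l) z < \<epsilon> l"
    if "legal \<epsilon> x (Suc l)" for \<epsilon> x
  proof -
    have "\<forall>i\<in>{1..l}. x (i+1) \<in> ball (x i) (d \<epsilon> x i)"
      using that unfolding legal_def atLeastLessThanSuc_atLeastAtMost by blast
    then have "\<exists>z. z \<in> f `` {x (l+1)} \<inter> ball (v \<epsilon> x l) (\<epsilon> l)"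
      using H[of \<epsilon> x] that unfolding Let_def d_def v_def legal_def by blast
    then show ?thesis by auto
  qed
  \<comment> \<open>The opponent may still replace \<open>\<epsilon> k\<close> and \<open>x (k + 1)\<close> at will: neither \<open>v \<epsilon> x k\<close> nor the earlier
      moduli see them, and \<open>d \<epsilon> x k\<close> does not see \<open>x (k + 1)\<close>.\<close>
  have extend: "(x k, v \<epsilon> x k) \<in> persistent X h"
    if k: "k \<in> {1..l}" and leg: "legal \<epsilon> x k"
      and reply: "\<And>\<epsilon>' z. legal \<epsilon>' z (Suc k) \<Longrightarrow> \<exists>y'. (z (Suc k), y') \<in> h \<and> dist (v \<epsilon>' z k) y' < \<epsilon>' k"
    for k \<epsilon> x h
  proof (rule persistentI)
    fix e :: real assume e: "e > 0"
    define \<epsilon>' where "\<epsilon>' = \<epsilon>(k := e)"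
    have d': "d \<epsilon>' x i = d \<epsilon> x i" if "i < k" for i
      using that by (auto simp: d_def \<epsilon>'_def intro!: arg_cong2[where f = "D i"])
    have leg': "legal \<epsilon>' x k" using leg d' e by (auto simp: legal_def \<epsilon>'_def)
    have "\<exists>y'. (x', y') \<in> h \<and> dist (v \<epsilon> x k) y' < e"
      if x': "x' \<in> X" "dist x' (x k) < d \<epsilon>' x k" for x'
    proof -
      define z where "z = x(Suc k := x')"
      have dz: "d \<epsilon>' z i = d \<epsilon>' x i" if "i \<le> k" for i
        using that by (auto simp: d_def z_def intro!: arg_cong2[where f = "D i"])
      have vz: "v \<epsilon>' z k = v \<epsilon> x k"
        by (auto simp: v_def z_def \<epsilon>'_def intro!: arg_cong2[where f = "Y k"])
      have "z (i+1) \<in> ball (z i) (d \<epsilon>' z i)" if "i \<in> {1..<Suc k}" for i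
      proof (cases "i = k")
        case True
        then show ?thesis using x' dz by (auto simp: z_def dist_commute)
      next
        case False
        then have "i \<in> {1..<k}" using that by auto
        then show ?thesis using leg' dz[of i] by (auto simp: z_def legal_def)
      qed
      then have "legal \<epsilon>' z (Suc k)" using leg' x' by (auto simp: legal_def z_def)
      from reply[OF this] show ?thesis by (simp add: vz) (simp add: z_def \<epsilon>'_def)
    qed
    then show "\<forall>\<^sub>F x' in nhds (x k). x' \<in> X \<longrightarrow> (\<exists>y'. (x', y') \<in> h \<and> dist (v \<epsilon> x k) y' < e)"
      using pos[OF leg' k] unfolding eventually_nhds_metric by blast
  qed
  have main: "(x k, v \<epsilon> x k) \<in> (persistent X ^^ Suc j) f"
    if "1 \<le> k" "k + j = l" "legal \<epsilon> x k" for k j \<epsilon> x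
    using that
  proof (induction j arbitrary: k \<epsilon> x)
    case (0 k \<epsilon> x)
    then have "(x k, v \<epsilon> x k) \<in> persistent X f"
      using final by (intro extend) auto
    then show ?case by simp
  next
    case (Suc j k \<epsilon> x)
    have "(x k, v \<epsilon> x k) \<in> persistent X ((persistent X ^^ Suc j) f)"
    proof (rule extend)
      fix \<epsilon>' z assume "legal \<epsilon>' z (Suc k)"
      then have "(z (Suc k), v \<epsilon>' z (Suc k)) \<in> (persistent X ^^ Suc j) f"
        "v \<epsilon>' z (Suc k) \<in> ball (v \<epsilon>' z k) (\<epsilon>' k)"
        using Suc.IH[of "Suc k" \<epsilon>' z] near[of \<epsilon>' z k] Suc.prems by auto
      then show "\<exists>y'. (z (Suc k), y') \<in> (persistent X ^^ Suc j) f \<and> dist (v \<epsilon>' z k) y' < \<epsilon>' k"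
        by (metis mem_ball)
    qed (use Suc.prems in auto)
    then show ?case by simp
  qed
  have "(x0, v (\<lambda>_. 1) (\<lambda>_. x0) 1) \<in> (persistent X ^^ Suc (l - 1)) f"
    by (rule main[where x = "\<lambda>_. x0"]) (use assms in \<open>auto simp: legal_def\<close>)
  then show ?thesis using assms by auto
qed

text \<open>A Lebesgue number argument: the moduli of finitely many points of \<open>g\<close> serve all the others, since
  a point inherits half the modulus of a close neighbour at twice the tolerance.\<close>

lemma persistent_uniform:
  assumes "compact g" "g \<subseteq> persistent X h" "e > 0"
  shows "\<exists>r>0. \<forall>x y x'. (x, y) \<in> g \<longrightarrow> x' \<in> X \<longrightarrow> dist x x' < r \<longrightarrow> (\<exists>y'. (x', y') \<in> h \<and> dist y y' < e)"
proof -
  have "\<exists>s>0. \<forall>x'. dist x' (fst p) < 2 * s \<longrightarrow> x' \<in> X \<longrightarrow> (\<exists>y'. (x', y') \<in> h \<and> dist (snd p) y' < e / 2)"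
    if "p \<in> g" for p
  proof -
    have "(fst p, snd p) \<in> persistent X h" using that assms by auto
    from persistentD[OF this, of "e/2"] assms(3)
    obtain r where "r > 0" "\<forall>x'. dist x' (fst p) < r \<longrightarrow> x' \<in> X \<longrightarrow> (\<exists>y'. (x', y') \<in> h \<and> dist (snd p) y' < e / 2)"
      by (auto simp: eventually_nhds_metric)
    then show ?thesis by (intro exI[of _ "r/2"]) auto
  qed
  then obtain s where s: "\<And>p. p \<in> g \<Longrightarrow> s p > 0"
    "\<And>p x'. p \<in> g \<Longrightarrow> dist x' (fst p) < 2 * s p \<Longrightarrow> x' \<in> X \<Longrightarrow> \<exists>y'. (x', y') \<in> h \<and> dist (snd p) y' < e / 2"
    by metis
  define U where "U p = ball p (min (s p) (e / 2))" for p
  have "g \<subseteq> (\<Union>p\<in>g. U p)" using s(1) assms(3) by (force simp: U_def)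
  moreover have "\<And>p. p \<in> g \<Longrightarrow> open (U p)" by (simp add: U_def)
  ultimately obtain C where C: "C \<subseteq> g" "finite C" "g \<subseteq> (\<Union>p\<in>C. U p)"
    using compactE_image[OF assms(1), of g U] by metis
  define r where "r = Min (insert 1 (s ` C))"
  have "r > 0" using C s(1) by (auto simp: r_def)
  moreover have "\<exists>y'. (x', y') \<in> h \<and> dist y y' < e"
    if "(x, y) \<in> g" "x' \<in> X" "dist x x' < r" for x y x'
  proof -
    from C(3) that(1) obtain p where p: "p \<in> C" "(x, y) \<in> U p" by blast
    have "r \<le> s p" using p C by (auto simp: r_def)
    have d: "dist p (x, y) < s p" "dist p (x, y) < e / 2" using p by (auto simp: U_def)
    have "dist (fst p) x < s p" "dist (snd p) y < e / 2"
      using d dist_fst_le[of p "(x,y)"] dist_snd_le[of p "(x,y)"] by auto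
    then have "dist x' (fst p) < 2 * s p"
      using that \<open>r \<le> s p\<close> dist_triangle[of x' "fst p" x] by (simp add: dist_commute)
    then obtain y' where y': "(x', y') \<in> h" "dist (snd p) y' < e / 2"
      using s(2)[of p x'] subsetD[OF C(1) p(1)] \<open>x' \<in> X\<close> by blast
    then have "dist y y' < e"
      using \<open>dist (snd p) y < e / 2\<close> dist_triangle[of y y' "snd p"] by (simp add: dist_commute)
    with y' show ?thesis by auto
  qed
  ultimately show ?thesis by blast
qed

text \<open>By uniformity, the \<open>k\<close>-th modulus can be chosen as a function of \<open>\<epsilon> k\<close> alone; the answers are
  picked greedily, each in the next relation of the chain.\<close>

lemma Henkin_continuous_chain:
  fixes F :: "nat \<Rightarrow> ('a::metric_space \<times> 'b::metric_space) set"
  assumes l: "l \<ge> 1"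
    and compact: "\<And>k. compact (F k)"
    and mono: "mono F"
    and total: "\<And>x. x \<in> X \<Longrightarrow> \<exists>y. (x, y) \<in> F 0"
    and persist: "\<And>k. F k \<subseteq> persistent X (F (Suc k))"
  shows "Henkin_continuous l X (F l)"
proof -
  obtain \<mu> where \<mu>: "\<And>k e. e > 0 \<Longrightarrow> \<mu> k e > 0"
    "\<And>k e x y x'. e > 0 \<Longrightarrow> (x, y) \<in> F k \<Longrightarrow> x' \<in> X \<Longrightarrow> dist x x' < \<mu> k e \<Longrightarrow>
       \<exists>y'. (x', y') \<in> F (Suc k) \<and> dist y y' < e"
  proof -
    have "\<forall>k e. \<exists>r. e > 0 \<longrightarrow> r > 0 \<and> (\<forall>x y x'. (x, y) \<in> F k \<longrightarrow> x' \<in> X \<longrightarrow> dist x x' < r \<longrightarrow>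
        (\<exists>y'. (x', y') \<in> F (Suc k) \<and> dist y y' < e))"
      using persistent_uniform[OF compact persist] by blast
    then obtain \<mu> where "\<forall>k e. e > 0 \<longrightarrow> \<mu> k e > 0 \<and>
        (\<forall>x y x'. (x, y) \<in> F k \<longrightarrow> x' \<in> X \<longrightarrow> dist x x' < \<mu> k e \<longrightarrow>
          (\<exists>y'. (x', y') \<in> F (Suc k) \<and> dist y y' < e))"
      by metis
    then show thesis by (intro that[of \<mu>]) blast+
  qed
  \<comment> \<open>\<open>V k\<close> is the answer to move \<open>k + 1\<close>, taken from \<open>F k\<close>.\<close>
  define V where "V = rec_nat (\<lambda>\<epsilon> x. SOME y. (x 1, y) \<in> F 0)
    (\<lambda>k w \<epsilon> x. SOME y. (x (k + 2), y) \<in> F (Suc k) \<and> dist (w \<epsilon> x) y < \<epsilon> (k + 1))"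
  have V0: "V 0 \<epsilon> x = (SOME y. (x 1, y) \<in> F 0)" 
    and VS: "V (Suc k) \<epsilon> x = (SOME y. (x (k + 2), y) \<in> F (Suc k) \<and> dist (V k \<epsilon> x) y < \<epsilon> (k + 1))"
    for \<epsilon> :: "nat \<Rightarrow> real" and x k
    by (simp_all add: V_def)
  have V_cong: "V k \<epsilon> x = V k \<epsilon>' x'"
    if "\<And>i. 1 \<le> i \<Longrightarrow> i \<le> k \<Longrightarrow> \<epsilon> i = \<epsilon>' i" "\<And>i. 1 \<le> i \<Longrightarrow> i \<le> k + 1 \<Longrightarrow> x i = x' i"
    for k \<epsilon> x \<epsilon>' x'
    using that
  proof (induction k)
    case 0
    then show ?case by (simp add: V0)
  next
    case (Suc k)
    then show ?case by (simp add: VS)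
  qed
  define Y where "Y k es xs = V (k - 1) (\<lambda>i. es ! (i - 1)) (\<lambda>i. xs ! (i - 1))" for k es xs
  define D where "D k es xs = \<mu> (k - 1) (es ! (k - 1))" for k and es :: "real list" and xs :: "'a list"
  show ?thesis
    unfolding Henkin_continuous_def
  proof (rule exI[of _ D], rule exI[of _ Y], intro allI impI, elim conjE)
    fix \<epsilon> :: "nat \<Rightarrow> real" and x :: "nat \<Rightarrow> 'a"
    assume \<epsilon>: "\<forall>k\<in>{1..l}. 0 < \<epsilon> k" and x: "\<forall>k\<in>{1..l+1}. x k \<in> X"
    have d: "D k (map \<epsilon> [1..<k+1]) (map x [1..<k]) = \<mu> (k - 1) (\<epsilon> k)" if "k \<ge> 1" for k
      using that by (simp add: D_def del: upt_Suc)
    have v: "Y k (map \<epsilon> [1..<k]) (map x [1..<k+1]) = V (k - 1) \<epsilon> x" if "k \<ge> 1" for k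
      unfolding Y_def by (rule V_cong) (use that in \<open>auto simp del: upt_Suc\<close>)
    have step: "(x (Suc k), V k \<epsilon> x) \<in> F k \<and> (k > 0 \<longrightarrow> dist (V (k - 1) \<epsilon> x) (V k \<epsilon> x) < \<epsilon> k)"
      if "k < l" "\<forall>i\<in>{1..k}. dist (x i) (x (i+1)) < \<mu> (i - 1) (\<epsilon> i)" for k
      using that
    proof (induction k)
      case 0
      then show ?case using someI_ex[OF total[of "x 1"]] l x by (auto simp: V0)
    next
      case (Suc k)
      then have "(x (Suc k), V k \<epsilon> x) \<in> F k" by auto
      moreover have "dist (x (Suc k)) (x (k + 2)) < \<mu> k (\<epsilon> (k + 1))"
        using Suc.prems(2)[rule_format, of "Suc k"] by simp
      ultimately have "\<exists>y. (x (k + 2), y) \<in> F (Suc k) \<and> dist (V k \<epsilon> x) y < \<epsilon> (k + 1)"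
        using \<mu>(2) \<epsilon> x Suc.prems(1) by auto
      from someI_ex[OF this] show ?case by (simp add: VS)
    qed
    have end_step: "\<exists>z. (x (l+1), z) \<in> F l \<and> dist (V (l - 1) \<epsilon> x) z < \<epsilon> l"
      if *: "\<forall>i\<in>{1..l}. dist (x i) (x (i+1)) < \<mu> (i - 1) (\<epsilon> i)"
    proof -
      have "(x (Suc (l - 1)), V (l - 1) \<epsilon> x) \<in> F (l - 1)"
        by (rule step[THEN conjunct1]) (use * l in auto)
      moreover have "dist (x l) (x (l+1)) < \<mu> (l - 1) (\<epsilon> l)" using * l by auto
      moreover have "\<epsilon> l > 0" "x (l+1) \<in> X" using \<epsilon> x l by auto
      ultimately show ?thesis
        using \<mu>(2)[of "\<epsilon> l" "x l" "V (l - 1) \<epsilon> x" "l - 1" "x (l+1)"] l by auto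
    qed
    show "let d = \<lambda>k. D k (map \<epsilon> [1..<k+1]) (map x [1..<k]);
              v = \<lambda>k. Y k (map \<epsilon> [1..<k]) (map x [1..<k+1])
          in (\<forall>k\<in>{1..l}. 0 < d k) \<and>
             (\<forall>k\<in>{1..l}. (\<forall>i\<in>{1..<k}. x (i+1) \<in> ball (x i) (d i)) \<longrightarrow>
                v k \<in> F l `` {x k} \<and> (1 < k \<longrightarrow> v k \<in> ball (v (k-1)) (\<epsilon> (k-1)))) \<and>
             ((\<forall>i\<in>{1..l}. x (i+1) \<in> ball (x i) (d i)) \<longrightarrow>
                (\<exists>z. z \<in> F l `` {x (l+1)} \<inter> ball (v l) (\<epsilon> l)))"
      unfolding Let_def
    proof (intro conjI ballI impI)
      fix k assume k: "k \<in> {1..l}"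
      show "0 < D k (map \<epsilon> [1..<k+1]) (map x [1..<k])"
        using k \<epsilon> \<mu>(1) d by auto
      assume "\<forall>i\<in>{1..<k}. x (i+1) \<in> ball (x i) (D i (map \<epsilon> [1..<i+1]) (map x [1..<i]))"
      then have *: "\<forall>i\<in>{1..k-1}. dist (x i) (x (i+1)) < \<mu> (i - 1) (\<epsilon> i)"
        using d k by (auto simp del: upt_Suc)
      have s: "(x k, V (k - 1) \<epsilon> x) \<in> F (k - 1)"
        "k > 1 \<Longrightarrow> dist (V (k - 1 - 1) \<epsilon> x) (V (k - 1) \<epsilon> x) < \<epsilon> (k - 1)"
        using step[of "k - 1"] * k by auto
      have "F (k - 1) \<subseteq> F l" using k by (intro monoD[OF mono]) auto
      with s(1) k show "Y k (map \<epsilon> [1..<k]) (map x [1..<k+1]) \<in> F l `` {x k}"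
        using v by (auto simp del: upt_Suc)
      assume k1: "1 < k"
      have "V (k - 1) \<epsilon> x \<in> ball (V (k - 1 - 1) \<epsilon> x) (\<epsilon> (k - 1))" using s(2) k1 by simp
      then show "Y k (map \<epsilon> [1..<k]) (map x [1..<k+1])
          \<in> ball (Y (k-1) (map \<epsilon> [1..<k-1]) (map x [1..<k-1+1])) (\<epsilon> (k-1))"
        using k1 v[of k] v[of "k - 1"] by (simp del: upt_Suc)
    next
      assume "\<forall>i\<in>{1..l}. x (i+1) \<in> ball (x i) (D i (map \<epsilon> [1..<i+1]) (map x [1..<i]))"
      then have *: "\<forall>i\<in>{1..l}. dist (x i) (x (i+1)) < \<mu> (i - 1) (\<epsilon> i)"
        using d by (auto simp del: upt_Suc)
      from end_step[OF *] show "\<exists>z. z \<in> F l `` {x (l+1)} \<inter> ball (Y l (map \<epsilon> [1..<l]) (map x [1..<l+1])) (\<epsilon> l)"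
        using v l by (auto simp del: upt_Suc)
    qed
  qed
qed

section \<open>The relations\<close>

text \<open>The value of the step that is not attained at \<open>x\<close>, though it is attained at \<open>0\<close>.\<close>

definition missed :: "real \<Rightarrow> real" where
  "missed x = of_bool (x < 0)"

definition jump :: "(real \<times> real) set" where
  "jump = {-1..0} \<times> {0} \<union> {0..1} \<times> {1}"

primrec nested_jumps :: "nat \<Rightarrow> (real \<times> real) set" where
  "nested_jumps 0 = jump"
| "nested_jumps (Suc k) = jump \<union>
     {(x, missed x + x * v) | x v. x \<in> {-1..1} \<and> x \<noteq> 0 \<and> (sin (1 / x), v) \<in> nested_jumps k}"

declare nested_jumps.simps(2) [simp del]

lemmas nested_jumps_Suc = nested_jumps.simps(2)

lemma jump_subset: "jump \<subseteq> nested_jumps k"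
  by (cases k) (auto simp: nested_jumps_Suc)

lemma nested_jumps_mono: "mono nested_jumps"
proof -
  have "nested_jumps k \<subseteq> nested_jumps (Suc k)" for k
    by (induction k) (auto simp: nested_jumps_Suc)
  then show ?thesis by (simp add: mono_iff_le_Suc)
qed

lemma nested_jumps_total:
  assumes "x \<in> {-1..1}"
  shows "\<exists>y. (x, y) \<in> nested_jumps k"
proof -
  have "(x, of_bool (x > 0)) \<in> jump" using assms by (auto simp: jump_def)
  then show ?thesis using jump_subset by blast
qed

lemma nested_jumps_bounded: "nested_jumps k \<subseteq> {-1..1} \<times> {0..1}"
proof (induction k)
  case 0
  then show ?case by (auto simp: jump_def)
next
  case (Suc k)
  have "missed x + x * v \<in> {0..1}" if "x \<in> {-1..1}" "(sin (1 / x), v) \<in> nested_jumps k" for x v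
  proof -
    have v: "0 \<le> v" "v \<le> 1" using Suc that by auto
    have "\<bar>x * v\<bar> \<le> 1 * 1"
      unfolding abs_mult by (rule mult_mono) (use v that in auto)
    moreover have "x \<ge> 0 \<Longrightarrow> x * v \<ge> 0" "x < 0 \<Longrightarrow> x * v \<le> 0"
      using v by (auto simp: mult_nonpos_nonneg)
    ultimately show ?thesis by (auto simp: missed_def)
  qed
  then show ?case by (auto simp: jump_def nested_jumps_Suc)
qed

lemma missed_locally_constant:
  assumes "x \<noteq> 0"
  shows "\<forall>\<^sub>F x' in nhds x. x' \<noteq> 0 \<and> missed x' = missed x"
proof (cases "x > 0")
  case True
  then have "\<forall>\<^sub>F x' in nhds x. x' \<in> {0<..}" by (intro eventually_nhds_in_open) auto
  then show ?thesis by eventually_elim (use True in \<open>auto simp: missed_def\<close>)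
next
  case False
  then have "\<forall>\<^sub>F x' in nhds x. x' \<in> {..<0}" using assms by (intro eventually_nhds_in_open) auto
  then show ?thesis by eventually_elim (use False assms in \<open>auto simp: missed_def\<close>)
qed

lemma jump_iff:
  assumes "x \<noteq> 0"
  shows "(x, y) \<in> jump \<longleftrightarrow> x \<in> {-1..1} \<and> y = 1 - missed x"
  using assms by (auto simp: jump_def missed_def)

text \<open>Away from \<open>x = 0\<close> the added part is a continuous preimage of the previous relation. As
  \<open>x\<close> tends to \<open>0\<close> its values tend to \<open>{0, 1}\<close>, and both of these belong to the step at \<open>0\<close>.\<close>

lemma compact_nested_jumps: "compact (nested_jumps k)"
proof (induction k)
  case 0
  then show ?case by (auto simp: jump_def intro!: compact_Un compact_Times)
next
  case (Suc k)
  let ?S = "{(x, missed x + x * v) | x v. x \<in> {-1..1} \<and> x \<noteq> 0 \<and> (sin (1 / x), v) \<in> nested_jumps k}"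
  have cl: "closed (nested_jumps k)" using Suc compact_imp_closed by blast
  have clj: "closed jump" by (auto simp: jump_def intro!: closed_Un closed_Times)
  have "closed (jump \<union> ?S)"
    unfolding closed_sequential_limits
  proof (intro allI impI, elim conjE)
    fix p :: "nat \<Rightarrow> real \<times> real" and q
    assume p: "\<forall>n. p n \<in> jump \<union> ?S" and lim: "p \<longlonglongrightarrow> q"
    obtain x y where q: "q = (x, y)" by force
    have limx: "(\<lambda>n. fst (p n)) \<longlonglongrightarrow> x" and limy: "(\<lambda>n. snd (p n)) \<longlonglongrightarrow> y"
      using tendsto_fst[OF lim] tendsto_snd[OF lim] q by auto
    have xr: "fst (p n) \<in> {-1..1}" for n
      using p[rule_format, of n] by (auto simp: jump_def)
    have x: "x \<in> {-1..1}"
      using closed_sequentially[OF closed_atLeastAtMost _ limx] xr by blast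
    show "q \<in> jump \<union> ?S"
    proof (cases "\<exists>\<^sub>F n in sequentially. p n \<in> jump")
      case True
      then have "\<exists>\<^sub>F n in sequentially. p n \<in> jump" by simp
      have "q \<in> jump"
      proof (rule ccontr)
        assume "q \<notin> jump"
        then have "\<forall>\<^sub>F n in sequentially. p n \<in> - jump"
          using topological_tendstoD[OF lim, of "- jump"] clj by auto
        with True show False by (simp add: frequently_def)
      qed
      then show ?thesis by simp
    next
      case False
      then have ev: "\<forall>\<^sub>F n in sequentially. p n \<in> ?S"
        unfolding not_frequently by eventually_elim (use p in auto)
      show ?thesis
      proof (cases "x = 0")
        case True
        \<comment> \<open>The quantity \<open>y * (y - 1)\<close> treats the two sides of \<open>0\<close> at once: its zeros are the values of
            the step at \<open>0\<close>.\<close>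
        have "\<forall>\<^sub>F n in sequentially. \<bar>snd (p n) * (snd (p n) - 1)\<bar> \<le> \<bar>fst (p n)\<bar>"
          using ev
        proof eventually_elim
          case (elim n)
          then obtain v where v: "snd (p n) = missed (fst (p n)) + fst (p n) * v" 
             "(sin (1 / fst (p n)), v) \<in> nested_jumps k" by auto
          have "v \<in> {0..1}" using v nested_jumps_bounded by blast
          then have b: "\<bar>fst (p n) * v\<bar> \<le> \<bar>fst (p n)\<bar>"
            unfolding abs_mult by (auto intro: mult_left_le)
          have "p n \<in> nested_jumps (Suc k)" using p by (simp only: nested_jumps_Suc)
          then have "p n \<in> {-1..1} \<times> {0..1}" using nested_jumps_bounded by blast
          then have r: "snd (p n) \<in> {0..1}"
            by (simp add: mem_Times_iff)
          show ?case
          proof (cases "fst (p n) < 0")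
            case True
            then have "\<bar>snd (p n) * (snd (p n) - 1)\<bar> = \<bar>snd (p n)\<bar> * \<bar>fst (p n) * v\<bar>"
              using v by (simp add: missed_def abs_mult)
            also have "\<dots> \<le> 1 * \<bar>fst (p n)\<bar>" by (rule mult_mono) (use b r in auto)
            finally show ?thesis by simp
          next
            case False
            then have "\<bar>snd (p n) * (snd (p n) - 1)\<bar> = \<bar>snd (p n) - 1\<bar> * \<bar>fst (p n) * v\<bar>"
              using v by (simp add: missed_def abs_mult)
            also have "\<dots> \<le> 1 * \<bar>fst (p n)\<bar>" by (rule mult_mono) (use b r in auto)
            finally show ?thesis by simp
          qed
        qed
        moreover have "(\<lambda>n. \<bar>snd (p n) * (snd (p n) - 1)\<bar>) \<longlonglongrightarrow> \<bar>y * (y - 1)\<bar>"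
          by (intro tendsto_intros limy)
        moreover have "(\<lambda>n. \<bar>fst (p n)\<bar>) \<longlonglongrightarrow> \<bar>x\<bar>" by (intro tendsto_intros limx)
        ultimately have "\<bar>y * (y - 1)\<bar> \<le> \<bar>x\<bar>"
          by (intro tendsto_le[OF sequentially_bot])
        then have "y = 0 \<or> y = 1" using True by simp
        then show ?thesis using True q by (auto simp: jump_def)
      next
        case False
        define v where "v n = (snd (p n) - missed x) / fst (p n)" for n
        have limv: "(\<lambda>n. (sin (1 / fst (p n)), v n)) \<longlonglongrightarrow> (sin (1 / x), (y - missed x) / x)"
          unfolding v_def by (intro tendsto_intros limx limy False)
        have "\<forall>\<^sub>F n in sequentially. fst (p n) \<noteq> 0 \<and> missed (fst (p n)) = missed x"
          using missed_locally_constant[OF False] limx by (rule eventually_compose_filterlim)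
        with ev have "\<forall>\<^sub>F n in sequentially. (sin (1 / fst (p n)), v n) \<in> nested_jumps k"
          by eventually_elim (auto simp: v_def)
        then have "(sin (1 / x), (y - missed x) / x) \<in> nested_jumps k"
          using Lim_in_closed_set[OF cl _ _ limv] by simp
        moreover have "y = missed x + x * ((y - missed x) / x)" using False by simp
        ultimately show ?thesis using False x q by blast
      qed
    qed
  qed
  moreover have "bounded (jump \<union> ?S)"
    using nested_jumps_bounded[of "Suc k"] 
    by (metis bounded_subset bounded_Times bounded_closed_interval nested_jumps_Suc)
  ultimately show ?case by (simp add: compact_eq_bounded_closed nested_jumps_Suc)
qed

lemma nested_jumps_near_missed:
  assumes "x \<in> {-1..1}" "c \<in> {0, 1}"
  shows "\<exists>y. (x, y) \<in> nested_jumps (Suc k) \<and> dist c y \<le> \<bar>x\<bar>"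
proof (cases "(x, c) \<in> jump")
  case True
  then show ?thesis using jump_subset[of "Suc k"] by (intro exI[of _ c]) auto
next
  case False
  then have x: "x \<noteq> 0" "c = missed x" using assms by (auto simp: jump_def missed_def)
  obtain v where v: "(sin (1 / x), v) \<in> nested_jumps k"
    using nested_jumps_total[of "sin (1 / x)" k] by auto
  then have "v \<in> {0..1}" using nested_jumps_bounded by blast
  then have "\<bar>x * v\<bar> \<le> \<bar>x\<bar>" unfolding abs_mult by (auto intro: mult_left_le)
  moreover have "(x, missed x + x * v) \<in> nested_jumps (Suc k)" using v x assms by (auto simp: nested_jumps_Suc)
  ultimately show ?thesis using x by (intro exI[of _ "missed x + x * v"]) (auto simp: dist_real_def)
qed

lemma jump_persistent: "jump \<subseteq> persistent {-1..1} (nested_jumps (Suc k))"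
proof clarify
  fix x y assume xy: "(x, y) \<in> jump"
  show "(x, y) \<in> persistent {-1..1} (nested_jumps (Suc k))"
  proof (rule persistentI)
    fix e :: real assume e: "e > 0"
    show "\<forall>\<^sub>F x' in nhds x. x' \<in> {-1..1} \<longrightarrow> (\<exists>y'. (x', y') \<in> nested_jumps (Suc k) \<and> dist y y' < e)"
    proof (cases "x = 0")
      case True
      have y: "y \<in> {0, 1}" using xy by (auto simp: jump_def)
      have "\<forall>\<^sub>F x' in nhds x. x' \<in> ball 0 e" using True e by (intro eventually_nhds_in_open) auto
      then show ?thesis
      proof eventually_elim
        case (elim x')
        then have "\<bar>x'\<bar> < e" by (simp add: dist_real_def)
        then show ?case using nested_jumps_near_missed[OF _ y, of x' k] by (meson order.strict_trans1)
      qed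
    next
      case False
      from missed_locally_constant[OF False] show ?thesis
      proof eventually_elim
        case (elim x')
        then show ?case using xy False jump_subset[of "Suc k"] e
          by (auto simp: jump_iff intro!: exI[of _ y])
      qed
    qed
  qed
qed

text \<open>Points of the added part inherit persistence from the previous stage, because they arise from it
  through maps that are continuous off \<open>0\<close>.\<close>

lemma nested_jumps_persistent: "nested_jumps k \<subseteq> persistent {-1..1} (nested_jumps (Suc k))"
proof (induction k)
  case 0
  show ?case unfolding nested_jumps.simps(1) by (rule jump_persistent)
next
  case (Suc k)
  have "(x, missed x + x * v) \<in> persistent {-1..1} (nested_jumps (Suc (Suc k)))"
    if x: "x \<in> {-1..1}" "x \<noteq> 0" and v: "(sin (1 / x), v) \<in> nested_jumps k" for x v
  proof (rule persistentI)
    fix e :: real assume e: "e > 0"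
    have "(sin (1 / x), v) \<in> persistent {-1..1} (nested_jumps (Suc k))" using Suc.IH v by (rule subsetD)
    then have "\<forall>\<^sub>F t in nhds (sin (1 / x)). t \<in> {-1..1} \<longrightarrow>
        (\<exists>v'. (t, v') \<in> nested_jumps (Suc k) \<and> dist v v' < e / 2)"
      by (rule persistentD) (use e in auto)
    moreover have "isCont (\<lambda>x. sin (1 / x)) x"
      by (intro continuous_intros x)
    then have "((\<lambda>x. sin (1 / x)) \<longlongrightarrow> sin (1 / x)) (nhds x)"
      by (simp add: isCont_def tendsto_nhds_iff)
    ultimately have "\<forall>\<^sub>F x' in nhds x. sin (1 / x') \<in> {-1..1} \<longrightarrow>
        (\<exists>v'. (sin (1 / x'), v') \<in> nested_jumps (Suc k) \<and> dist v v' < e / 2)"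
      by (rule eventually_compose_filterlim)
    moreover have "\<forall>\<^sub>F x' in nhds x. x' \<in> ball x (e / 2)" using e by (intro eventually_nhds_in_open) auto
    moreover note missed_locally_constant[OF x(2)]
    ultimately show "\<forall>\<^sub>F x' in nhds x. x' \<in> {-1..1} \<longrightarrow>
        (\<exists>y'. (x', y') \<in> nested_jumps (Suc (Suc k)) \<and> dist (missed x + x * v) y' < e)"
    proof eventually_elim
      case (elim x')
      show ?case
      proof
        assume x': "x' \<in> {-1..1}"
        obtain v' where v': "(sin (1 / x'), v') \<in> nested_jumps (Suc k)" "dist v v' < e / 2"
          using elim(1) by auto
        have "(x', missed x' + x' * v') \<in> nested_jumps (Suc (Suc k))"
          using x' v' elim(3) unfolding nested_jumps_Suc[of "Suc k"] by blast
        moreover have "dist (x * v) (x' * v') < e"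
        proof -
          have "v \<in> {0..1}" using v nested_jumps_bounded by blast
          have "x * v - x' * v' = (x - x') * v + x' * (v - v')" by (simp add: algebra_simps)
          also have "\<bar>\<dots>\<bar> \<le> \<bar>x - x'\<bar> * \<bar>v\<bar> + \<bar>x'\<bar> * \<bar>v - v'\<bar>"
            by (metis abs_mult abs_triangle_ineq)
          also have "\<dots> \<le> \<bar>x - x'\<bar> + \<bar>v - v'\<bar>"
            using \<open>v \<in> {0..1}\<close> x' by (intro add_mono mult_left_le mult_left_le_one_le) auto
          also have "\<dots> < e" using v'(2) elim(2) by (simp add: dist_real_def)
          finally show ?thesis by (simp add: dist_real_def)
        qed
        ultimately show "\<exists>y'. (x', y') \<in> nested_jumps (Suc (Suc k)) \<and> dist (missed x + x * v) y' < e"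
          using elim(3) by (intro exI[of _ "missed x' + x' * v'"]) (auto simp: dist_real_def)
      qed
    qed
  qed
  then show ?case using jump_persistent[of "Suc k"] by (auto simp: nested_jumps_Suc[of k])
qed

section \<open>The point zero\<close>

text \<open>Continuous right inverses of \<open>x \<mapsto> sin (1 / x)\<close>: the \<open>n\<close>-th one embeds a full copy of the
  previous relation in the next one. Taking \<open>n\<close> large and of either sign brings the copy close to \<open>0\<close>
  on either side.\<close>

definition branch :: "int \<Rightarrow> real \<Rightarrow> real" where
  "branch n t = 1 / (arcsin t + 2 * pi * of_int n)"

lemma branch_denom:
  assumes "t \<in> {-1..1}" "n \<noteq> 0"
  shows "\<bar>arcsin t + 2 * pi * of_int n\<bar> \<ge> \<bar>real_of_int n\<bar>"
    "arcsin t + 2 * pi * of_int n < 0 \<longleftrightarrow> n < 0"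
proof -
  have a: "\<bar>arcsin t\<bar> \<le> pi / 2" using arcsin_bounded[of t] assms by auto
  have "\<bar>real_of_int n\<bar> \<ge> 1" using assms(2) by linarith
  have p: "pi \<ge> 2" using pi_ge_two by simp
  have "2 * pi * \<bar>real_of_int n\<bar> - pi / 2 \<ge> \<bar>real_of_int n\<bar>"
  proof -
    have "(2 * pi - 1) * 1 \<le> (2 * pi - 1) * \<bar>real_of_int n\<bar>"
      by (rule mult_left_mono) (use p \<open>\<bar>real_of_int n\<bar> \<ge> 1\<close> in auto)
    then show ?thesis using p by (simp add: algebra_simps)
  qed
  moreover have "\<bar>2 * pi * real_of_int n\<bar> = 2 * pi * \<bar>real_of_int n\<bar>" by (simp add: abs_mult)
  moreover have "2 * pi * real_of_int n < 0 \<longleftrightarrow> n < 0" by (simp add: mult_less_0_iff)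
  ultimately show "\<bar>arcsin t + 2 * pi * of_int n\<bar> \<ge> \<bar>real_of_int n\<bar>"
    "arcsin t + 2 * pi * of_int n < 0 \<longleftrightarrow> n < 0"
    using a \<open>\<bar>real_of_int n\<bar> \<ge> 1\<close> by linarith+
qed

lemma branch_props:
  assumes "t \<in> {-1..1}" "n \<noteq> 0"
  shows "branch n t \<noteq> 0" "branch n t \<in> {-1..1}" "sin (1 / branch n t) = t" "missed (branch n t) = of_bool (n < 0)"
proof -
  note d = branch_denom[OF assms]
  have n: "\<bar>real_of_int n\<bar> \<ge> 1" using assms(2) by linarith
  then show nz: "branch n t \<noteq> 0" using d by (auto simp: branch_def)
  have "\<bar>branch n t\<bar> \<le> 1" using d n by (auto simp: branch_def divide_le_eq)
  then show "branch n t \<in> {-1..1}" by auto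
  show "sin (1 / branch n t) = t" using assms by (simp add: branch_def sin_add)
  show "missed (branch n t) = of_bool (n < 0)" using d by (auto simp: missed_def branch_def)
qed

text \<open>Off the step, the next relation is over the range of \<open>branch n\<close> a homeomorphic copy of the
  previous one. Being off the step, whose value there is \<open>1 - of_bool (n < 0)\<close>, is an open condition,
  so nearby witnesses of persistence also lie in the copy.\<close>

lemma persistent_transport:
  assumes n: "n \<noteq> 0" and t: "t \<in> {-1..1}"
    and "(branch n t, y) \<in> (persistent {-1..1} ^^ j) (nested_jumps (Suc k))"
    and "y \<noteq> 1 - of_bool (n < 0)"
  shows "(t, (y - of_bool (n < 0)) / branch n t) \<in> (persistent {-1..1} ^^ j) (nested_jumps k)"
  using assms(2-)
proof (induction j arbitrary: t y)
  case 0
  note b_props = branch_props[OF 0(1) n]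
  have "(branch n t, y) \<notin> jump"
    using 0(3) b_props by (auto simp: jump_iff)
  then show ?case using 0(2) b_props by (auto simp: nested_jumps_Suc)
next
  case (Suc j)
  define b :: real where "b = of_bool (n < 0)"
  note b_props = branch_props[OF Suc.prems(1) n]
  have per: "(branch n t, y) \<in> persistent {-1..1} ((persistent {-1..1} ^^ j) (nested_jumps (Suc k)))"
    using Suc.prems by simp
  have "(t, (y - b) / branch n t) \<in> persistent {-1..1} ((persistent {-1..1} ^^ j) (nested_jumps k))"
  proof (rule persistentI)
    fix e :: real assume e: "e > 0"
    have "isCont (\<lambda>p. (snd p - b) / fst p) (branch n t, y)"
      using b_props(1) by (intro continuous_intros) auto
    then have "((\<lambda>p. (snd p - b) / fst p) \<longlongrightarrow> (y - b) / branch n t) (nhds (branch n t, y))"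
      by (simp add: isCont_def tendsto_nhds_iff)
    then have "\<forall>\<^sub>F p in nhds (branch n t, y). dist ((snd p - b) / fst p) ((y - b) / branch n t) < e"
      using e by (rule tendstoD)
    then obtain P Q where PQ: "eventually P (nhds (branch n t))" "eventually Q (nhds y)"
      "\<And>x' y'. P x' \<Longrightarrow> Q y' \<Longrightarrow> dist ((y' - b) / x') ((y - b) / branch n t) < e"
      unfolding nhds_prod eventually_prod_filter by auto
    obtain r where r: "r > 0" "\<And>y'. dist y' y < r \<Longrightarrow> Q y'"
      using PQ(2) by (auto simp: eventually_nhds_metric)
    define s where "s = min r (dist y (1 - b))"
    have "s > 0" using r Suc.prems by (simp add: s_def b_def)
    from persistentD[OF per this] PQ(1)
    have ev: "\<forall>\<^sub>F x' in nhds (branch n t). P x' \<and> (x' \<in> {-1..1} \<longrightarrow>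
        (\<exists>y'. (x', y') \<in> (persistent {-1..1} ^^ j) (nested_jumps (Suc k)) \<and> dist y y' < s))"
      by eventually_elim auto
    have "continuous_on {-1..1} (branch n)"
      unfolding branch_def using branch_denom(1)[OF _ n] n by (intro continuous_intros) force+
    then have "(branch n \<longlongrightarrow> branch n t) (at t within {-1..1})"
      using Suc.prems(1) by (simp add: continuous_on_def)
    from eventually_compose_filterlim[OF ev this] eventually_nhds_x_imp_x[OF ev]
    have "\<forall>\<^sub>F t' in nhds t. t' \<in> {-1..1} \<longrightarrow> P (branch n t') \<and> (branch n t' \<in> {-1..1} \<longrightarrow>
        (\<exists>y'. (branch n t', y') \<in> (persistent {-1..1} ^^ j) (nested_jumps (Suc k)) \<and> dist y y' < s))"
      unfolding eventually_at_filter by (elim eventually_mono) metis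
    then show "\<forall>\<^sub>F t' in nhds t. t' \<in> {-1..1} \<longrightarrow>
        (\<exists>v'. (t', v') \<in> (persistent {-1..1} ^^ j) (nested_jumps k) \<and> dist ((y - b) / branch n t) v' < e)"
    proof eventually_elim
      case (elim t')
      show ?case
      proof
        assume t': "t' \<in> {-1..1}"
        then obtain y' where y': "P (branch n t')"
          "(branch n t', y') \<in> (persistent {-1..1} ^^ j) (nested_jumps (Suc k))" "dist y y' < s"
          using elim branch_props(2)[OF t' n] by auto
        have "y' \<noteq> 1 - b" using y'(3) by (auto simp: s_def)
        then have "(t', (y' - b) / branch n t') \<in> (persistent {-1..1} ^^ j) (nested_jumps k)"
          using Suc.IH[OF t' y'(2)] by (simp add: b_def)
        moreover have "dist ((y - b) / branch n t) ((y' - b) / branch n t') < e"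
          using PQ(3)[OF y'(1) r(2)] y'(3) by (simp add: s_def dist_commute)
        ultimately show "\<exists>v'. (t', v') \<in> (persistent {-1..1} ^^ j) (nested_jumps k) \<and>
            dist ((y - b) / branch n t) v' < e" by blast
      qed
    qed
  qed
  then show ?case by (simp add: b_def)
qed

text \<open>No \<open>y\<close> is equal to both values of the step. Approaching \<open>0\<close> from the side where the step
  avoids \<open>y\<close>, witnesses close to \<open>y\<close> are off the step.\<close>

lemma persistent_at_zero:
  fixes y :: real
  assumes "(0, y) \<in> persistent {-1..1} h"
  shows "\<exists>n y'. n \<noteq> 0 \<and> (branch n 0, y') \<in> h \<and> y' \<noteq> 1 - of_bool (n < 0)"
proof -
  obtain \<sigma> :: int where \<sigma>: "\<sigma> \<in> {1, -1}" "y \<noteq> 1 - of_bool (\<sigma> < 0)"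
  proof (cases "y = 1")
    case True
    then show ?thesis by (intro that[of "-1"]) auto
  next
    case False
    then show ?thesis by (intro that[of 1]) auto
  qed
  have "(\<lambda>m. 1 / (2 * pi * of_int \<sigma>) * inverse (real (Suc m))) \<longlonglongrightarrow> 1 / (2 * pi * of_int \<sigma>) * 0"
    by (rule tendsto_mult_left[OF LIMSEQ_inverse_real_of_nat])
  moreover have "branch (\<sigma> * int (Suc m)) 0 = 1 / (2 * pi * of_int \<sigma>) * inverse (real (Suc m))" for m
    unfolding branch_def of_int_mult of_int_of_nat_eq arcsin_0 by (simp only: add_0_left divide_inverse
        mult_1_left inverse_mult_distrib mult.assoc)
  ultimately have "(\<lambda>m. branch (\<sigma> * int (Suc m)) 0) \<longlonglongrightarrow> 0" by (simp only: mult_zero_right)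
  then have lim: "filterlim (\<lambda>m. branch (\<sigma> * int (Suc m)) 0) (nhds 0) sequentially" .
  define r where "r = dist y (1 - of_bool (\<sigma> < 0))"
  have "r > 0" using \<sigma>(2) by (simp add: r_def)
  from eventually_compose_filterlim[OF persistentD[OF assms this] lim]
  have "\<forall>\<^sub>F m in sequentially. branch (\<sigma> * int (Suc m)) 0 \<in> {-1..1} \<longrightarrow>
      (\<exists>y'. (branch (\<sigma> * int (Suc m)) 0, y') \<in> h \<and> dist y y' < r)" .
  then obtain m where m: "branch (\<sigma> * int (Suc m)) 0 \<in> {-1..1} \<longrightarrow>
      (\<exists>y'. (branch (\<sigma> * int (Suc m)) 0, y') \<in> h \<and> dist y y' < r)"
    by (rule eventually_happens'[OF sequentially_bot, THEN exE])
  define n where "n = \<sigma> * int (Suc m)"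
  have n: "n \<noteq> 0" "n < 0 \<longleftrightarrow> \<sigma> < 0"
    using \<sigma>(1) by (auto simp: n_def mult_less_0_iff simp del: of_nat_Suc)
  have "branch n 0 \<in> {-1..1}" by (rule branch_props(2)) (use n(1) in simp_all)
  then obtain y' where y': "(branch n 0, y') \<in> h" "dist y y' < r"
    using m unfolding n_def by blast
  have "y' \<noteq> 1 - of_bool (n < 0)" using y'(2) unfolding r_def n(2) by blast
  then show ?thesis using n(1) y'(1) by blast
qed

lemma zero_not_persistent: "(0, y) \<notin> (persistent {-1..1} ^^ Suc k) (nested_jumps k)"
proof (induction k arbitrary: y)
  case 0
  show ?case
  proof
    assume "(0, y) \<in> (persistent {-1..1} ^^ Suc 0) (nested_jumps 0)"
    then obtain n y' where n: "n \<noteq> 0" "(branch n 0, y') \<in> jump" "y' \<noteq> 1 - of_bool (n < 0)"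
      using persistent_at_zero[of y jump] by auto
    then show False
      using branch_props[of 0 n] by (auto simp: jump_iff)
  qed
next
  case (Suc k)
  show ?case
  proof
    assume "(0, y) \<in> (persistent {-1..1} ^^ Suc (Suc k)) (nested_jumps (Suc k))"
    then have "(0, y) \<in> persistent {-1..1} ((persistent {-1..1} ^^ Suc k) (nested_jumps (Suc k)))"
      by simp
    from persistent_at_zero[OF this] obtain n y' where n: "n \<noteq> 0"
      "(branch n 0, y') \<in> (persistent {-1..1} ^^ Suc k) (nested_jumps (Suc k))"
      "y' \<noteq> 1 - of_bool (n < 0)" by blast
    then show False
      using persistent_transport[OF n(1) _ n(2,3)] Suc.IH by simp
  qed
qed

theorem mainTheorem4:
  fixes l :: nat
  assumes "l \<ge> 1"
  shows "\<exists>f :: (real \<times> real) set.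
           compact f \<and> total_relation {-1..1} {-1..2} f \<and>
           Henkin_continuous l {-1..1} f \<and> \<not> Henkin_continuous (l + 1) {-1..1} f"
proof (intro exI conjI)
  show "compact (nested_jumps l)" by (rule compact_nested_jumps)
  show "total_relation {-1..1} {-1..2} (nested_jumps l)"
    unfolding total_relation_def
  proof
    have "{-1..1} \<times> {0..1} \<subseteq> {-1..1} \<times> {-1..2 :: real}" by auto
    then show "nested_jumps l \<subseteq> {-1..1} \<times> {-1..2}" using nested_jumps_bounded by blast
    show "\<forall>x\<in>{-1..1}. nested_jumps l `` {x} \<noteq> {}" using nested_jumps_total by blast
  qed
  show "Henkin_continuous l {-1..1} (nested_jumps l)"
    using assms compact_nested_jumps nested_jumps_mono nested_jumps_total nested_jumps_persistent
    by (rule Henkin_continuous_chain)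
  show "\<not> Henkin_continuous (l + 1) {-1..1} (nested_jumps l)"
    using Henkin_continuous_imp_persistent[of "l + 1" "{-1..1}" "nested_jumps l" 0]
      zero_not_persistent[of _ l] by auto
qed

end
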